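(* Let $(X,\mathcal A,\mu)$ be a $\sigma$-finite complete measure space, $T:X\to X$ a non-singular measurable transformation with $\mu(T(A))\le\mu(A)$ for all $A\in\mathcal A$, and $u:X\to\mathbb C$ a measurable function which is bounded away from zero (there is $\epsilon>0$ with $|u(x)|>\epsilon$ a.e. on $X$), such that $W_{u,T}$ is a bounded operator on $L(p,q)$. If $k\in\mathbb N\cup\{0\}$ is the smallest number such that $T_k=T|_{T^k(X)}:T^k(X)\to T^{k+1}(X)$ is injective almost everywhere on $T^k(X)$, then $\beta(W_{u,T})\le k$.
   Context: For measurable $h:X\to\mathbb C$ put $\mu_h(s)=\mu(\{x\in X:|h(x)|>s\})$ for $s\ge 0$, $h^*(t)=\inf\{s>0:\mu_h(s)\le t\}$ and $h^{**}(t)=\frac1t\int_0^t h^*(s)\,ds$ for $t>0$. The Lorentz space $L(p,q)$ (for $1<p<\infty$, $1\le q<\infty$, or $1<p\le\infty$, $q=\infty$) is the Banach space of (a.e.-equivalence classes of) measurable $h:X\to\mathbb C$ with $\|h\|_{pq}<\infty$, where $\|h\|_{pq}=\left(\frac qp\int_0^\infty (t^{1/p}h^{**}(t))^q\frac{dt}{t}\right)^{1/q}$ if $1<p<\infty$, $1\le q<\infty$, and $\|h\|_{pq}=\sup_{t>0}t^{1/p}h^{**}(t)$ if $1<p\le\infty$, $q=\infty$. A measurable transformation $T:X\to X$ is non-singular if $\mu(A)=0$ implies $\mu(T^{-1}(A))=0$. The hypothesis $\mu(T(A))\le\mu(A)$ for $A\in\mathcal A$ includes that $T(A)\in\mathcal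 A$. $W_{u,T}f=(u\circ T)\cdot(f\circ T)$. The map $T_k$ is injective almost everywhere on $T^k(X)$ if the set $\{x\in T^k(X):\exists\,y\in T^k(X),\ y\neq x,\ T(x)=T(y)\}$ is measurable with $\mu$-measure zero. For a bounded operator $L$ with range $\mathcal R(L)$, the descent is $\beta(L)=\inf\{k\in\mathbb N\cup\{0\}:\mathcal R(L^{k+1})=\mathcal R(L^k)\}$ (equal to $\infty$ if no such $k$ exists). *)

theory Defs
  imports "HOL-Analysis.Analysis"
begin

definition distr_fun :: "'a measure \<Rightarrow> ('a \<Rightarrow> complex) \<Rightarrow> real \<Rightarrow> ennreal" where
  "distr_fun M h s = emeasure M {x \<in> space M. cmod (h x) > s}"

text \<open>The infimum is taken in \<^typ>\<open>ennreal\<close>, so the value is infinite when no \<open>s\<close> qualifies.\<close>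

definition rearrangement :: "'a measure \<Rightarrow> ('a \<Rightarrow> complex) \<Rightarrow> real \<Rightarrow> ennreal" where
  "rearrangement M h t = Inf {ennreal s | s. s > 0 \<and> distr_fun M h s \<le> ennreal t}"

definition avg_rearrangement :: "'a measure \<Rightarrow> ('a \<Rightarrow> complex) \<Rightarrow> real \<Rightarrow> ennreal" where
  "avg_rearrangement M h t = (\<integral>\<^sup>+ s\<in>{0<..<t}. rearrangement M h s \<partial>lborel) / ennreal t"

text \<open>Real powers of extended nonnegative reals; used for exponents \<open>a > 0\<close> only.\<close>

definition ennreal_rpow :: "ennreal \<Rightarrow> real \<Rightarrow> ennreal" where
  "ennreal_rpow x a = (if x = \<infinity> then \<infinity> else ennreal (enn2real x powr a))"

text \<open>
  For \<open>p = \<infinity>\<close> the exponent \<open>enn2real (1 / p)\<close> is \<open>0\<close>, so the weight \<open>t\<^sup>1\<^sup>/\<^sup>p\<close> is \<open>1\<close>.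
\<close>

definition Lorentz_norm :: "'a measure \<Rightarrow> ennreal \<Rightarrow> ennreal \<Rightarrow> ('a \<Rightarrow> complex) \<Rightarrow> ennreal" where
  "Lorentz_norm M p q h =
     (if q = \<infinity>
      then (SUP t\<in>{0<..}. ennreal (t powr enn2real (1 / p)) * avg_rearrangement M h t)
      else ennreal_rpow
             (q / p *
               (\<integral>\<^sup>+ t\<in>{0<..}.
                  ennreal_rpow (ennreal (t powr enn2real (1 / p)) * avg_rearrangement M h t) (enn2real q)
                    / ennreal t \<partial>lborel))
             (enn2real (1 / q)))"

definition Lorentz_exponents :: "ennreal \<Rightarrow> ennreal \<Rightarrow> bool" where
  "Lorentz_exponents p q \<longleftrightarrow>
     (1 < p \<and> p < \<infinity> \<and> 1 \<le> q \<and> q < \<infinity>) \<or> (1 < p \<and> p \<le> \<infinity> \<and> q = \<infinity>)"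

definition ae_eq :: "'a measure \<Rightarrow> (('a \<Rightarrow> complex) \<times> ('a \<Rightarrow> complex)) set" where
  "ae_eq M = {(f, g). f \<in> borel_measurable M \<and> g \<in> borel_measurable M \<and> (AE x in M. f x = g x)}"

definition Lorentz_space :: "'a measure \<Rightarrow> ennreal \<Rightarrow> ennreal \<Rightarrow> ('a \<Rightarrow> complex) set set" where
  "Lorentz_space M p q = {h \<in> borel_measurable M. Lorentz_norm M p q h < \<infinity>} // ae_eq M"

text \<open>The norm is constant on each a.e.-class, so its image of a class is a singleton.\<close>

definition Lorentz_class_norm :: "'a measure \<Rightarrow> ennreal \<Rightarrow> ennreal \<Rightarrow> ('a \<Rightarrow> complex) set \<Rightarrow> ennreal" where
  "Lorentz_class_norm M p q F = the_elem (Lorentz_norm M p q ` F)"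

definition nonsingular :: "'a measure \<Rightarrow> ('a \<Rightarrow> 'a) \<Rightarrow> bool" where
  "nonsingular M T \<longleftrightarrow>
     (\<forall>A\<in>sets M. emeasure M A = 0 \<longrightarrow> emeasure M (T -` A \<inter> space M) = 0)"

definition weighted_comp :: "('a \<Rightarrow> complex) \<Rightarrow> ('a \<Rightarrow> 'a) \<Rightarrow> ('a \<Rightarrow> complex) \<Rightarrow> 'a \<Rightarrow> complex" where
  "weighted_comp u T f = (\<lambda>x. u (T x) * f (T x))"

text \<open>
  The operator induced on a.e.-classes. It maps the class of \<open>f\<close> to the class of
  \<open>weighted_comp u T f\<close>; this does not depend on \<open>f\<close> when \<open>T\<close> is non-singular.
\<close>

definition W_op ::
    "'a measure \<Rightarrow> ('a \<Rightarrow> complex) \<Rightarrow> ('a \<Rightarrow> 'a) \<Rightarrow> ('a \<Rightarrow> complex) set \<Rightarrow> ('a \<Rightarrow> complex) set" where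
  "W_op M u T F = ae_eq M `` (weighted_comp u T ` F)"

text \<open>
  Linearity is not part of this predicate: it is automatic for \<^const>\<open>W_op\<close>.
\<close>

definition bounded_op_on :: "'v set \<Rightarrow> ('v \<Rightarrow> ennreal) \<Rightarrow> ('v \<Rightarrow> 'v) \<Rightarrow> bool" where
  "bounded_op_on V nrm L \<longleftrightarrow>
     L ` V \<subseteq> V \<and> (\<exists>C::real. C \<ge> 0 \<and> (\<forall>v\<in>V. nrm (L v) \<le> ennreal C * nrm v))"

text \<open>The infimum of the empty set in \<^typ>\<open>enat\<close> is \<open>\<infinity>\<close>.\<close>

definition descent :: "'v set \<Rightarrow> ('v \<Rightarrow> 'v) \<Rightarrow> enat" where
  "descent V L = Inf {enat k | k. (L ^^ (k + 1)) ` V = (L ^^ k) ` V}"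

definition inj_ae_on_iterate :: "'a measure \<Rightarrow> ('a \<Rightarrow> 'a) \<Rightarrow> nat \<Rightarrow> bool" where
  "inj_ae_on_iterate M T k \<longleftrightarrow>
     (let Y = (T ^^ k) ` space M; N = {x \<in> Y. \<exists>y\<in>Y. y \<noteq> x \<and> T x = T y}
      in N \<in> sets M \<and> emeasure M N = 0)"

end

theory Submission
  imports Defs
begin

text \<open>
  The inclusion of the range of \<open>W\<^sup>k\<^sup>+\<^sup>1\<close> in that of \<open>W\<^sup>k\<close> is clear. Conversely, given \<open>f\<close>, remove
  from \<open>T\<^sup>k(X)\<close> the null set on which \<open>T\<close> is not injective, and let \<open>g = (f \<circ> T\<^sup>-\<^sup>1) / u\<close> on the image
  of what remains and \<open>g = 0\<close> elsewhere. Then \<open>(u \<circ> T) (g \<circ> T) = f\<close> a.e. on \<open>T\<^sup>k(X)\<close>, so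
  \<open>W\<^sup>k\<^sup>+\<^sup>1 g = W\<^sup>k f\<close>. As \<open>T\<close> does not increase the measure of sets and \<open>\<bar>u\<bar> > \<epsilon>\<close>, the distribution
  functions satisfy \<open>\<mu>\<^sub>g(s) \<le> \<mu>\<^sub>f(\<epsilon> s)\<close>, hence \<open>\<epsilon> g\<^sup>*\<^sup>* \<le> f\<^sup>*\<^sup>*\<close> and \<open>g\<close> lies in the Lorentz space.
\<close>

section \<open>Lorentz norms and distribution functions\<close>

text \<open>Unlike \<open>nn_integral_cmult\<close>, this inequality does not require \<open>f\<close> to be measurable.\<close>

lemma nn_integral_cmult_le:
  "c * (\<integral>\<^sup>+ x. f x \<partial>M) \<le> (\<integral>\<^sup>+ x. c * f x \<partial>M)"
  unfolding nn_integral_def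
proof (subst SUP_mult_left_ennreal, rule SUP_least)
  fix g assume g: "g \<in> {g. simple_function M g \<and> g \<le> f}"
  then have "simple_function M (\<lambda>x. c * g x)" "(\<lambda>x. c * g x) \<le> (\<lambda>x. c * f x)"
    by (auto simp: le_fun_def intro!: mult_left_mono)
  moreover have "c * integral\<^sup>S M g = integral\<^sup>S M (\<lambda>x. c * g x)"
    using g by simp
  ultimately show "c * integral\<^sup>S M g \<le> (SUP g\<in>{g. simple_function M g \<and> g \<le> (\<lambda>x. c * f x)}. integral\<^sup>S M g)"
    by (auto intro: SUP_upper)
qed

lemma ennreal_rpow_mono:
  assumes "x \<le> y" "0 \<le> a"
  shows "ennreal_rpow x a \<le> ennreal_rpow y a"
  using assms unfolding ennreal_rpow_def
  by (auto simp: top_unique less_top intro!: ennreal_leI powr_mono2 enn2real_mono)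

lemma ennreal_rpow_cmult:
  assumes "0 < c"
  shows "ennreal_rpow (ennreal c * x) a = ennreal (c powr a) * ennreal_rpow x a"
proof (cases x)
  case (real r)
  then have "ennreal c * x = ennreal (c * r)"
    using assms by (simp add: ennreal_mult')
  then have "ennreal_rpow (ennreal c * x) a = ennreal ((c * r) powr a)"
    using real assms by (simp add: ennreal_rpow_def)
  then show ?thesis
    using real assms by (simp add: ennreal_rpow_def powr_mult ennreal_mult)
next
  case top
  then show ?thesis
    using assms by (simp add: ennreal_rpow_def ennreal_mult_top)
qed

lemma ennreal_rpow_less_top_iff: "ennreal_rpow x a < top \<longleftrightarrow> x < top"
  by (simp add: ennreal_rpow_def less_top)

text \<open>If a level \<open>s\<close> is admissible in the infimum for \<open>f\<close>, then
  \<open>s / c\<close> is admissible in the one for \<open>g\<close>, as the hypothesis at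
  \<open>s / c\<close> shows.\<close>

lemma rearrangement_scale:
  assumes "0 < c" and "\<And>s. 0 < s \<Longrightarrow> distr_fun M g s \<le> distr_fun M f (c * s)"
  shows "ennreal c * rearrangement M g t \<le> rearrangement M f t"
  unfolding rearrangement_def[of M f]
proof (rule Inf_greatest)
  fix x assume "x \<in> {ennreal s |s. 0 < s \<and> distr_fun M f s \<le> ennreal t}"
  then obtain s where s: "x = ennreal s" "0 < s" "distr_fun M f s \<le> ennreal t"
    by blast
  have "distr_fun M g (s / c) \<le> ennreal t"
    using assms(2)[of "s / c"] s assms(1) by auto
  then have "rearrangement M g t \<le> ennreal (s / c)"
    unfolding rearrangement_def using s(2) assms(1) by (intro Inf_lower) auto
  then have "ennreal c * rearrangement M g t \<le> ennreal c * ennreal (s / c)"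
    by (rule mult_left_mono) simp
  also have "\<dots> = x"
    using s assms(1) by (simp flip: ennreal_mult)
  finally show "ennreal c * rearrangement M g t \<le> x" .
qed

lemma avg_rearrangement_scale:
  assumes "0 < c" and "\<And>s. 0 < s \<Longrightarrow> distr_fun M g s \<le> distr_fun M f (c * s)"
  shows "ennreal c * avg_rearrangement M g t \<le> avg_rearrangement M f t"
proof -
  have "ennreal c * (\<integral>\<^sup>+ s\<in>{0<..<t}. rearrangement M g s \<partial>lborel)
      \<le> (\<integral>\<^sup>+ s. ennreal c * (rearrangement M g s * indicator {0<..<t} s) \<partial>lborel)"
    by (rule nn_integral_cmult_le)
  also have "\<dots> \<le> (\<integral>\<^sup>+ s\<in>{0<..<t}. rearrangement M f s \<partial>lborel)"
    using rearrangement_scale[OF assms]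
    by (intro nn_integral_mono) (auto simp: indicator_def)
  finally show ?thesis
    unfolding avg_rearrangement_def ennreal_times_divide by (rule divide_right_mono_ennreal)
qed

text \<open>Both forms of the norm are monotone in the weighted average \<open>F\<close>, so the
  bound on averages carries finiteness from \<open>f\<close> over to \<open>g\<close>.\<close>

lemma Lorentz_norm_finite_scale:
  assumes c: "0 < c" and distr: "\<And>s. 0 < s \<Longrightarrow> distr_fun M g s \<le> distr_fun M f (c * s)"
    and fin: "Lorentz_norm M p q f < \<infinity>"
  shows "Lorentz_norm M p q g < \<infinity>"
proof -
  define F where "F h t = ennreal (t powr enn2real (1 / p)) * avg_rearrangement M h t" for h t
  have F: "ennreal c * F g t \<le> F f t" for t
    using avg_rearrangement_scale[OF c distr, where t = t] unfolding F_def
    by (subst mult.left_commute) (auto intro!: mult_left_mono)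
  have finite_if: "y < top" if "ennreal d * y \<le> z" "z < top" "0 < d" for d y z
  proof -
    have "ennreal d * y < top"
      using that by (rule_tac le_less_trans)
    then show ?thesis
      using that(3) by (auto simp: ennreal_mult_less_top)
  qed
  show ?thesis
  proof (cases "q = \<infinity>")
    case True
    have "ennreal c * (SUP t\<in>{0<..}. F g t) \<le> (SUP t\<in>{0<..}. F f t)"
      unfolding SUP_mult_left_ennreal using F by (intro SUP_mono) blast
    then show ?thesis
      using finite_if c fin True by (auto simp: Lorentz_norm_def F_def)
  next
    case False
    define I where "I h = (\<integral>\<^sup>+ t\<in>{0<..}. ennreal_rpow (F h t) (enn2real q) / ennreal t \<partial>lborel)" for h
    \<comment> \<open>The factor \<open>c\<close> stands inside a \<open>q\<close>-th power under
      the integral and leaves it as \<open>c powr enn2real q\<close>.\<close>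
    define d where "d = c powr enn2real q"
    have d: "0 < d"
      using c by (simp add: d_def)
    have "ennreal d * I g \<le> (\<integral>\<^sup>+ t. ennreal d * (ennreal_rpow (F g t) (enn2real q) / ennreal t
        * indicator {0<..} t) \<partial>lborel)"
      unfolding I_def by (rule nn_integral_cmult_le)
    also have "\<dots> \<le> I f"
      unfolding I_def
    proof (rule nn_integral_mono)
      fix t :: real
      have "ennreal d * ennreal_rpow (F g t) (enn2real q) \<le> ennreal_rpow (F f t) (enn2real q)"
        unfolding d_def ennreal_rpow_cmult[OF c, symmetric] using F by (rule ennreal_rpow_mono) simp
      then have "ennreal d * (ennreal_rpow (F g t) (enn2real q) / ennreal t)
          \<le> ennreal_rpow (F f t) (enn2real q) / ennreal t"
        unfolding ennreal_times_divide by (rule divide_right_mono_ennreal)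
      then show "ennreal d * (ennreal_rpow (F g t) (enn2real q) / ennreal t * indicator {0<..} t)
          \<le> ennreal_rpow (F f t) (enn2real q) / ennreal t * indicator {0<..} t"
        by (auto simp: indicator_def)
    qed
    finally have "ennreal d * (q / p * I g) \<le> q / p * I f"
      by (subst mult.left_commute) (rule mult_left_mono, simp_all)
    \<comment> \<open>The outer power does not affect finiteness, so it suffices to compare the
      quantities under it.\<close>
    moreover have norm: "Lorentz_norm M p q h = ennreal_rpow (q / p * I h) (enn2real (1 / q))" for h
      using False by (simp add: Lorentz_norm_def I_def F_def)
    ultimately show ?thesis
      using finite_if d fin by (auto simp: ennreal_rpow_less_top_iff)
  qed
qed

section \<open>Weighted composition on a.e.-classes\<close>

lemma AE_nonsingular:
  assumes T: "T \<in> M \<rightarrow>\<^sub>M M" "nonsingular M T" and P: "AE x in M. P x"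
  shows "AE x in M. P (T x)"
proof -
  obtain N where N: "{x \<in> space M. \<not> P x} \<subseteq> N" "emeasure M N = 0" "N \<in> sets M"
    using P by (rule AE_E)
  show ?thesis
  proof (rule AE_I)
    show "{x \<in> space M. \<not> P (T x)} \<subseteq> T -` N \<inter> space M"
      using N(1) measurable_space[OF T(1)] by auto
    show "emeasure M (T -` N \<inter> space M) = 0"
      using T(2) N by (auto simp: nonsingular_def)
    show "T -` N \<inter> space M \<in> sets M"
      using T(1) N(3) by (rule measurable_sets)
  qed
qed

lemma AE_nonsingular_funpow:
  assumes T: "T \<in> M \<rightarrow>\<^sub>M M" "nonsingular M T" and P: "AE x in M. P x"
  shows "AE x in M. P ((T ^^ n) x)"
proof (induction n)
  case (Suc n)
  from AE_nonsingular[OF T this] show ?case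
    by (simp add: funpow_swap1)
qed (use P in simp)

lemma weighted_comp_measurable:
  assumes "T \<in> M \<rightarrow>\<^sub>M M" "u \<in> borel_measurable M" "f \<in> borel_measurable M"
  shows "(weighted_comp u T ^^ n) f \<in> borel_measurable M"
proof (induction n)
  case (Suc n)
  with assms(1,2) show ?case
    unfolding funpow.simps comp_def weighted_comp_def[of u T "(weighted_comp u T ^^ n) f"]
    by measurable
qed (use assms in simp)

text \<open>The \<open>n\<close>-th iterate at \<open>x\<close> is the product of the
  \<open>u ((T ^^ i) x)\<close> for 1 \<le> i \<le> n, times the value of the function at
  \<open>(T ^^ n) x\<close>.\<close>

lemma weighted_comp_funpow_cong:
  assumes "g ((T ^^ n) x) = f ((T ^^ n) x)"
  shows "(weighted_comp u T ^^ n) g x = (weighted_comp u T ^^ n) f x"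
  using assms
proof (induction n arbitrary: x)
  case (Suc n)
  then have "(weighted_comp u T ^^ n) g (T x) = (weighted_comp u T ^^ n) f (T x)"
    by (simp add: funpow_swap1)
  then show ?case
    by (simp add: weighted_comp_def[of u T "(weighted_comp u T ^^ n) _"])
qed simp

lemma equiv_ae_eq: "equiv (borel_measurable M) (ae_eq M)"
proof (rule equivI)
  show "trans (ae_eq M)"
  proof (rule transI)
    fix f g h assume "(f, g) \<in> ae_eq M" "(g, h) \<in> ae_eq M"
    then have "f \<in> borel_measurable M" "h \<in> borel_measurable M"
      and "AE x in M. f x = g x" "AE x in M. g x = h x"
      by (auto simp: ae_eq_def)
    then show "(f, h) \<in> ae_eq M"
      unfolding ae_eq_def by (auto elim: AE_mp)
  qed
qed (auto simp: ae_eq_def refl_on_def sym_def eq_commute)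

text \<open>\<open>W_op\<close> is a union of classes, one for each representative; non-singularity
  makes all of them equal.\<close>

lemma W_op_class:
  assumes T: "T \<in> M \<rightarrow>\<^sub>M M" "nonsingular M T" and u: "u \<in> borel_measurable M"
    and f: "f \<in> borel_measurable M"
  shows "W_op M u T (ae_eq M `` {f}) = ae_eq M `` {weighted_comp u T f}"
proof -
  have "(weighted_comp u T f, weighted_comp u T g) \<in> ae_eq M" if "(f, g) \<in> ae_eq M" for g
  proof -
    from that have "g \<in> borel_measurable M" and "AE x in M. f x = g x"
      by (auto simp: ae_eq_def)
    moreover from AE_nonsingular[OF T this(2)]
    have "AE x in M. weighted_comp u T f x = weighted_comp u T g x"
      by (auto simp: weighted_comp_def)
    ultimately show ?thesis
      using weighted_comp_measurable[OF T(1) u, where n = 1] f by (simp add: ae_eq_def)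
  qed
  then have "ae_eq M `` {weighted_comp u T g} = ae_eq M `` {weighted_comp u T f}"
    if "(f, g) \<in> ae_eq M" for g
    using that equiv_class_eq[OF equiv_ae_eq] by blast
  \<comment> \<open>By reflexivity the union ranges over at least one representative.\<close>
  moreover have "(f, f) \<in> ae_eq M"
    using f by (simp add: ae_eq_def)
  ultimately show ?thesis
    unfolding W_op_def by blast
qed

lemma W_op_funpow_class:
  assumes T: "T \<in> M \<rightarrow>\<^sub>M M" "nonsingular M T" and u: "u \<in> borel_measurable M"
    and f: "f \<in> borel_measurable M"
  shows "(W_op M u T ^^ n) (ae_eq M `` {f}) = ae_eq M `` {(weighted_comp u T ^^ n) f}"
  by (induction n) (simp_all add: W_op_class[OF T u] weighted_comp_measurable[OF T(1) u f])

section \<open>Solving \<open>W g = f\<close> on a set where \<open>T\<close> is injective\<close>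

lemma weighted_comp_preimage:
  assumes T: "T \<in> M \<rightarrow>\<^sub>M M"
    and image: "\<And>B. B \<in> sets M \<Longrightarrow> T ` B \<in> sets M \<and> emeasure M (T ` B) \<le> emeasure M B"
    and u: "u \<in> borel_measurable M" and \<epsilon>: "0 < \<epsilon>" "AE x in M. cmod (u x) > \<epsilon>"
    and A: "A \<in> sets M" "inj_on T A"
    and f: "f \<in> borel_measurable M"
  obtains g where "g \<in> borel_measurable M"
    and "\<And>x. x \<in> A \<Longrightarrow> u (T x) \<noteq> 0 \<Longrightarrow> weighted_comp u T g x = f x"
    and "\<And>s. 0 < s \<Longrightarrow> distr_fun M g s \<le> distr_fun M f (\<epsilon> * s)"
proof
  define S where "S = the_inv_into A T"
  have S: "S (T x) = x" if "x \<in> A" for x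
    using A(2) that by (simp add: S_def the_inv_into_f_f)
  define h where "h z = (if z \<in> T ` A then f (S z) else 0)" for z
  \<comment> \<open>Division by zero yields 0, so \<open>g\<close> vanishes wherever
    \<open>u\<close> does. Hence \<open>?w g = f\<close> is claimed only at points with
    \<open>u (T x) \<noteq> 0\<close>.\<close>
  define g where "g z = h z / u z" for z
  have TA: "T ` A \<in> sets M"
    using image A(1) by blast
  have "S \<in> restrict_space M (T ` A) \<rightarrow>\<^sub>M M"
  proof (rule measurableI)
    fix z assume "z \<in> space (restrict_space M (T ` A))"
    then show "S z \<in> space M"
      using S sets.sets_into_space[OF A(1)] by (auto simp: space_restrict_space)
  next
    fix B assume "B \<in> sets M"
    then have "T ` (A \<inter> B) \<in> sets M"
      using image A(1) by blast
    moreover have "S -` B \<inter> space (restrict_space M (T ` A)) = T ` (A \<inter> B)"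
      using S sets.sets_into_space[OF TA] by (auto simp: space_restrict_space)
    ultimately show "S -` B \<inter> space (restrict_space M (T ` A)) \<in> sets (restrict_space M (T ` A))"
      using TA by (auto simp: sets_restrict_space_iff)
  qed
  then have "(\<lambda>z. f (S z)) \<in> borel_measurable (restrict_space M (T ` A))"
    using f by (rule measurable_compose)
  then have "h \<in> borel_measurable M"
    unfolding h_def using TA by (subst (asm) measurable_restrict_space_iff[where c = 0]) auto
  then show "g \<in> borel_measurable M"
    unfolding g_def using u by measurable
  show "weighted_comp u T g x = f x" if "x \<in> A" "u (T x) \<noteq> 0" for x
    using that S by (simp add: weighted_comp_def g_def h_def)
  show "distr_fun M g s \<le> distr_fun M f (\<epsilon> * s)" if s: "0 < s" for s
  proof -
    let ?B = "{x \<in> A. cmod (f x) > \<epsilon> * s}"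
    have B: "?B \<in> sets M"
    proof -
      have "?B = A \<inter> {x \<in> space M. cmod (f x) > \<epsilon> * s}"
        using sets.sets_into_space[OF A(1)] by auto
      also have "\<dots> \<in> sets M"
        using A(1) f by measurable
      finally show ?thesis .
    qed
    have "distr_fun M g s \<le> emeasure M (T ` ?B)"
      unfolding distr_fun_def
    proof (rule emeasure_mono_AE)
      show "AE x in M. x \<in> {x \<in> space M. cmod (g x) > s} \<longrightarrow> x \<in> T ` ?B"
        using \<epsilon>(2)
      proof (rule AE_mp, intro AE_I2 impI)
        fix z assume uz: "cmod (u z) > \<epsilon>" and "z \<in> {x \<in> space M. cmod (g x) > s}"
        then have gz: "cmod (h z) / cmod (u z) > s"
          by (simp add: g_def norm_divide)
        then have z: "z \<in> T ` A"
          using s by (auto simp: h_def split: if_splits)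
        then obtain x where x: "x \<in> A" "z = T x"
          by blast
        have "\<epsilon> * s < cmod (u z) * s"
          using uz s by simp
        also have "\<dots> < cmod (h z)"
          using gz pos_less_divide_eq[OF less_trans[OF \<epsilon>(1) uz]] by (simp only: mult.commute)
        also have "h z = f x"
          using x S by (auto simp: h_def)
        finally show "z \<in> T ` ?B"
          using x by auto
      qed
    qed (use image B in auto)
    also have "\<dots> \<le> emeasure M ?B"
      using image B by blast
    also have "\<dots> \<le> distr_fun M f (\<epsilon> * s)"
      unfolding distr_fun_def using sets.sets_into_space[OF A(1)] f
      by (intro emeasure_mono) auto
    finally show ?thesis .
  qed
qed

theorem theorem4p22:
  fixes M :: "'a measure" and T :: "'a \<Rightarrow> 'a" and u :: "'a \<Rightarrow> complex"
    and p q :: ennreal and k :: nat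
  assumes "sigma_finite_measure M" and "complete_measure M"
    and "Lorentz_exponents p q"
    and "T \<in> M \<rightarrow>\<^sub>M M" and "nonsingular M T"
    and "\<And>A. A \<in> sets M \<Longrightarrow> T ` A \<in> sets M \<and> emeasure M (T ` A) \<le> emeasure M A"
    and "u \<in> borel_measurable M"
    and "\<exists>\<epsilon>>0. AE x in M. cmod (u x) > \<epsilon>"
    and "bounded_op_on (Lorentz_space M p q) (Lorentz_class_norm M p q) (W_op M u T)"
    and "inj_ae_on_iterate M T k"
    and "\<And>j. inj_ae_on_iterate M T j \<Longrightarrow> k \<le> j"
  shows "descent (Lorentz_space M p q) (W_op M u T) \<le> enat k"
proof -
  note T = assms(4,5) and image = assms(6) and u = assms(7)
  let ?V = "Lorentz_space M p q" and ?W = "W_op M u T" and ?w = "weighted_comp u T"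
  obtain \<epsilon> where \<epsilon>: "0 < \<epsilon>" "AE x in M. cmod (u x) > \<epsilon>"
    using assms(8) by blast
  define Y where "Y = (T ^^ k) ` space M"
  define N where "N = {x \<in> Y. \<exists>y\<in>Y. y \<noteq> x \<and> T x = T y}"
  have N: "N \<in> sets M" "emeasure M N = 0"
    using assms(10) by (simp_all add: inj_ae_on_iterate_def Y_def N_def Let_def)
  have "(T ^^ n) ` space M \<in> sets M" for n
  proof (induction n)
    case (Suc n)
    with image have "T ` ((T ^^ n) ` space M) \<in> sets M"
      by blast
    then show ?case
      by (simp add: image_comp)
  qed simp
  \<comment> \<open>Two distinct points of \<open>Y\<close> with the same image both lie in
    \<open>N\<close>, so removing \<open>N\<close> leaves \<open>T\<close> injective.\<close>
  then have A: "Y - N \<in> sets M" "inj_on T (Y - N)"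
    using N(1) by (auto simp: Y_def N_def inj_on_def)
  have "AE y in M. y \<notin> N"
    using N by (intro AE_not_in) (simp add: null_sets_def)
  moreover have "AE y in M. u (T y) \<noteq> 0"
    using AE_nonsingular[OF T \<epsilon>(2)] by (rule AE_mp) (use \<epsilon>(1) in auto)
  ultimately have "AE y in M. y \<notin> N \<and> u (T y) \<noteq> 0"
    by simp
  \<comment> \<open>The exceptional points are null among the \<open>y = (T ^^ k) x\<close>;
    non-singularity makes the set of the corresponding \<open>x\<close> null too. Membership in
    \<open>Y\<close> holds for every \<open>x\<close> in the space.\<close>
  from AE_nonsingular_funpow[OF T this, of k]
  have good: "AE x in M. (T ^^ k) x \<in> Y - N \<and> u (T ((T ^^ k) x)) \<noteq> 0"
    by (rule AE_mp) (auto simp: Y_def)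

  \<comment> \<open>One factor is applied first, and it maps \<open>?V\<close> into itself.\<close>
  have "(?W ^^ (k + 1)) ` ?V \<subseteq> (?W ^^ k) ` ?V"
    using assms(9) by (auto simp: bounded_op_on_def funpow_swap1)
  moreover have "(?W ^^ k) ` ?V \<subseteq> (?W ^^ (k + 1)) ` ?V"
  proof (rule image_subsetI)
    fix F assume "F \<in> ?V"
    then obtain f where f: "f \<in> borel_measurable M" "Lorentz_norm M p q f < \<infinity>"
      and F: "F = ae_eq M `` {f}"
      unfolding Lorentz_space_def by (auto elim: quotientE)
    obtain g where g: "g \<in> borel_measurable M"
      and wg: "\<And>x. x \<in> Y - N \<Longrightarrow> u (T x) \<noteq> 0 \<Longrightarrow> ?w g x = f x"
      and distr: "\<And>s. 0 < s \<Longrightarrow> distr_fun M g s \<le> distr_fun M f (\<epsilon> * s)"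
      using weighted_comp_preimage[OF T(1) image u \<epsilon> A f(1)] by blast
    have "Lorentz_norm M p q g < \<infinity>"
      using Lorentz_norm_finite_scale[OF \<epsilon>(1) distr f(2)] .
    with g have G: "ae_eq M `` {g} \<in> ?V"
      unfolding Lorentz_space_def by (intro quotientI) simp
    \<comment> \<open>Written as \<open>(?w ^^ k) (?w g)\<close>, the left side depends on
      \<open>?w g\<close> only at \<open>(T ^^ k) x\<close>. For a.e. \<open>x\<close> this point is
      in \<open>Y - N\<close> with \<open>u\<close> nonzero at its image, so \<open>?w g\<close>
      agrees with \<open>f\<close> there.\<close>
    have "AE x in M. (?w ^^ (k + 1)) g x = (?w ^^ k) f x"
      using good
      by (rule AE_mp) (auto simp: funpow_Suc_right simp del: funpow.simps
          intro!: AE_I2 weighted_comp_funpow_cong wg)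
    then have "((?w ^^ (k + 1)) g, (?w ^^ k) f) \<in> ae_eq M"
      unfolding ae_eq_def using weighted_comp_measurable[OF T(1) u] f(1) g by blast
    then have "(?W ^^ (k + 1)) (ae_eq M `` {g}) = (?W ^^ k) F"
      unfolding F W_op_funpow_class[OF T u g] W_op_funpow_class[OF T u f(1)]
      by (rule equiv_class_eq[OF equiv_ae_eq])
    with G show "(?W ^^ k) F \<in> (?W ^^ (k + 1)) ` ?V"
      by (metis image_eqI)
  qed
  ultimately show ?thesis
    unfolding descent_def by (intro Inf_lower) blast
qed

end
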